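(* For real (or complex) $x$ with $|x|<\frac1{16}$, $$\sum_{n=0}^\infty V_nx^n=\frac{1}{1-16x}\sum_{k=0}^\infty\binom{2k}{k}^3\Big(\frac{-x}{(1-16x)^2}\Big)^k.$$
   Context: For $n\ge0$, $V_n=\sum_{k=0}^n\binom{2k}{k}^2\binom{2n-2k}{n-k}^2$.
   Formalization: The right-hand series diverges for some |x|<1/16 (e.g. x=1/32, argument -1/8), so the identity is proved whenever that series converges, and for all |x|<1/16 with its sum replaced by its analytic continuation to the plane cut along [1/64,∞). *)

theory Defs
  imports "HOL-Complex_Analysis.Complex_Analysis"
begin

definition V :: "nat \<Rightarrow> nat" where
  "V n = (\<Sum>k=0..n. ((2 * k) choose k)\<^sup>2 * ((2 * n - 2 * k) choose (n - k))\<^sup>2)"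

text \<open>The power series of the cubes of the central binomial coefficients has radius of
  convergence 1/64, and its sum continues analytically to the plane cut along the real
  half-line from 1/64 to infinity. This continuation is needed because for some \<open>x\<close> with
  \<open>norm x < 1/16\<close> (for example \<open>x = 1/32\<close>) the point \<open>-x / (1 - 16 * x)\<^sup>2\<close> lies outside the
  disc of convergence.\<close>

definition cut_plane :: "complex set" where
  "cut_plane = - {complex_of_real t | t. 1/64 \<le> t}"

end

theory Submission
  imports Defs
begin

text \<open>
  The generating function of \<^const>\<open>V\<close> is \<open>g = f\<^sup>2\<close>, where \<open>f\<close> is the series of squared central
  binomial coefficients. With \<open>P = x (1 - 16 x)\<close>, the equation \<open>(P f')' = 4 f\<close> yields a third-order equation
  for \<open>g\<close>, hence a three-term recurrence for \<^const>\<open>V\<close>. The coefficients of the right-hand side satisfy the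
  same recurrence, by creative telescoping; so both sides agree near \<open>0\<close>.

  Up to scaling, \<open>x \<mapsto> - x / (1 - 16 x)\<^sup>2\<close> is the Koebe function: it maps the disc of radius \<open>1/16\<close>
  bijectively onto the cut plane, with inverse \<open>(s - 1) / (16 (s + 1))\<close>, \<open>s = \<surd>(1 - 64 z)\<close>. Therefore
  \<open>(1 - 16 x) g(x)\<close>, transported to the cut plane, is the required continuation. The cubes
  are bounded by \<open>64 ^ k * (k + 1) powr (-3/2)\<close>, so their series is continuous up to its circle of convergence and
  agrees with the continuation there too.
\<close>

unbundle no vec_syntax

section \<open>Central binomial coefficients and their power series\<close>

abbreviation cb :: "nat \<Rightarrow> nat" where
  "cb k \<equiv> (2 * k) choose k"

text \<open>Absorption is applied twice, from row \<open>2 * k + 2\<close> down to row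
  \<open>2 * k\<close>; the symmetry of the odd row in between joins the two.\<close>

lemma cb_Suc: "Suc k * cb (Suc k) = 2 * (2 * k + 1) * cb k"
proof -
  have 1: "Suc k * cb (Suc k) = Suc (2 * k + 1) * ((2 * k + 1) choose k)"
    using Suc_times_binomial_eq[of "2 * k + 1" k] by (simp add: mult.commute)
  have "(2 * k + 1) choose k = (2 * k + 1) choose Suc k"
    by (subst binomial_symmetric) auto
  hence 2: "Suc k * ((2 * k + 1) choose k) = Suc (2 * k) * cb k"
    using Suc_times_binomial_eq[of "2 * k" k] by (simp add: mult.commute)
  have "Suc k * cb (Suc k) = 2 * (Suc k * ((2 * k + 1) choose k))"
    unfolding 1 by (simp add: algebra_simps)
  thus ?thesis
    unfolding 2 by simp
qed

lemma of_nat_cb_Suc: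
  "(of_nat k + 1) * of_nat (cb (Suc k)) = (2 * (2 * of_nat k + 1) * of_nat (cb k) :: 'a :: comm_semiring_1)"
  using arg_cong[OF cb_Suc[of k], of "of_nat :: nat \<Rightarrow> 'a"]
  by (simp add: of_nat_mult algebra_simps del: binomial_Suc_Suc mult_Suc mult_Suc_right)

text \<open>For \<open>r = 2\<close> this is 2/\<pi> times the complete elliptic integral K at
  squared modulus 16 x.\<close>

definition cb_fps :: "nat \<Rightarrow> 'a :: field_char_0 fps" where
  "cb_fps r = Abs_fps (\<lambda>k. of_nat (cb k) ^ r)"

lemma V_eq_fps_nth: "of_nat (V n) = (cb_fps 2 ^ 2 :: 'a :: field_char_0 fps) $ n"
  by (simp add: V_def cb_fps_def power2_eq_square fps_mult_nth diff_mult_distrib2)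

section \<open>Differential equations and the recurrence for \<open>V\<close>\<close>

definition elliptic_P :: "'a :: field_char_0 fps" where
  "elliptic_P = fps_X - 16 * fps_X ^ 2"

lemma elliptic_P_mult_deriv_nth:
  "(elliptic_P * fps_deriv F) $ Suc n = of_nat (Suc n) * F $ Suc n - 16 * of_nat n * F $ n"
proof -
  have "elliptic_P * fps_deriv F = fps_X * (fps_deriv F - 16 * (fps_X * fps_deriv F))"
    by (simp add: elliptic_P_def power2_eq_square algebra_simps)
  thus ?thesis
    by (cases n) (simp_all add: fps_mult_numeral_left)
qed

text \<open>Coefficientwise this is the square of the two-term recurrence, since 4 (2 n + 1)^2 - 16
  n (n + 1) = 4.\<close>

lemma cb_fps_2_ode: "fps_deriv (elliptic_P * fps_deriv (cb_fps 2)) = 4 * (cb_fps 2 :: 'a :: field_char_0 fps)"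
proof (rule fps_ext)
  fix n
  let ?c = "\<lambda>n. of_nat (cb n) :: 'a"
  have "fps_deriv (elliptic_P * fps_deriv (cb_fps 2)) $ n =
          ((of_nat n + 1) * ?c (Suc n))\<^sup>2 - 16 * of_nat n * (of_nat n + 1) * ?c n ^ 2"
    by (simp add: elliptic_P_mult_deriv_nth cb_fps_def power2_eq_square algebra_simps
             del: fps_deriv_mult binomial_Suc_Suc mult_Suc mult_Suc_right)
  also have "\<dots> = 4 * ?c n ^ 2"
    unfolding of_nat_cb_Suc by (simp add: power2_eq_square algebra_simps)
  finally show "fps_deriv (elliptic_P * fps_deriv (cb_fps 2)) $ n = (4 * (cb_fps 2 :: 'a fps)) $ n"
    by (simp add: cb_fps_def fps_mult_numeral_left)
qed

text \<open>This is the symmetric square of the equation for f. With h = P f', both h' = 4 f and P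
  f' = h, so differentiating f^2 only produces f^2, f h and h^2; the last derivative leaves f h and
  f^2, and f h is again a multiple of P (f^2)'.\<close>

lemma symmetric_square_ode:
  fixes f P :: "'a :: field_char_0 fps"
  assumes "fps_deriv (P * fps_deriv f) = 4 * f"
  shows   "fps_deriv (P * fps_deriv (P * fps_deriv (f ^ 2))) =
             16 * (P * fps_deriv (f ^ 2)) + 8 * (fps_deriv P * f ^ 2)"
proof -
  define h where "h = P * fps_deriv f"
  have h: "fps_deriv h = 4 * f"
    using assms by (simp add: h_def)
  have *: "P * fps_deriv (f ^ 2) = 2 * (f * h)"
    by (simp add: h_def power2_eq_square algebra_simps)
  have "P * fps_deriv (P * fps_deriv (f ^ 2)) = 2 * h ^ 2 + 8 * (P * f ^ 2)"
    unfolding * by (simp add: h power2_eq_square) (simp add: h_def algebra_simps)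
  thus ?thesis
    by (simp add: h power2_eq_square) (simp add: h_def algebra_simps)
qed

text \<open>Compares the coefficients of x^(m + 1) in the third-order equation for the generating
  function g.\<close>

lemma V_rec:
  "of_nat (m + 2) ^ 3 * of_nat (V (m + 2)) =
     (8 * (2 * of_nat m + 3) * (2 * of_nat m ^ 2 + 6 * of_nat m + 5) * of_nat (V (m + 1))
      - 256 * of_nat (m + 1) ^ 3 * of_nat (V m) :: 'a :: field_char_0)"
proof -
  define g :: "'a fps" where "g = cb_fps 2 ^ 2"
  define B where "B = elliptic_P * fps_deriv g"
  have B: "B $ Suc n = of_nat (Suc n) * g $ Suc n - 16 * of_nat n * g $ n" for n
    by (simp add: B_def elliptic_P_mult_deriv_nth)
  have P': "fps_deriv (elliptic_P :: 'a fps) = 1 - 32 * fps_X"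
    by (simp add: elliptic_P_def power2_eq_square)
  have "fps_deriv (elliptic_P * fps_deriv B) $ Suc m = (16 * B + 8 * ((1 - 32 * fps_X) * g)) $ Suc m"
    using symmetric_square_ode[OF cb_fps_2_ode, where ?'a = 'a] by (simp add: B_def g_def P')
  hence "of_nat (m + 2) * (of_nat (m + 2) * B $ Suc (Suc m) - 16 * of_nat (Suc m) * B $ Suc m)
          = 16 * B $ Suc m + 8 * g $ Suc m - 256 * g $ m"
    by (simp add: elliptic_P_mult_deriv_nth fps_mult_numeral_left ring_distribs mult.assoc del: fps_deriv_mult)
  thus ?thesis
    unfolding B V_eq_fps_nth g_def[symmetric]
    by (simp add: algebra_simps power2_eq_square power3_eq_cube)
qed

section \<open>Coefficients of the right-hand side and creative telescoping\<close>

text \<open>The coefficient of \<open>x ^ n\<close> in \<open>x ^ k / (1 - 16 * x) ^ (2 * k + 1)\<close>.\<close>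

definition koebe_coeff :: "nat \<Rightarrow> nat \<Rightarrow> 'a :: field_char_0" where
  "koebe_coeff n k = of_nat ((n + k) choose (2 * k)) * 16 ^ n / 16 ^ k"

lemma koebe_coeff_eq_0: "n < k \<Longrightarrow> koebe_coeff n k = 0"
  by (simp add: koebe_coeff_def)

lemma koebe_coeff_self: "koebe_coeff n n = 1"
  by (simp add: koebe_coeff_def flip: mult_2)

text \<open>Absorption in the complementary lower index n - k. The factor
  \<open>of_nat n + 1 - of_nat k\<close> vanishes at k = n + 1, so the identity extends to all
  k.\<close>

lemma koebe_coeff_Suc_left:
  "(of_nat n + 1 - of_nat k) * koebe_coeff (Suc n) k =
     16 * (of_nat n + 1 + of_nat k) * (koebe_coeff n k :: 'a :: field_char_0)"
proof (cases "k \<le> n")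
  case True
  then obtain d where d: "n = k + d" by (metis le_iff_add)
  have "Suc d * (Suc (2 * k + d) choose Suc d) = Suc (2 * k + d) * ((2 * k + d) choose d)"
    using Suc_times_binomial_eq[of "2 * k + d" d] by (simp add: mult.commute)
  also have "(2 * k + d) choose d = (2 * k + d) choose (2 * k)"
    by (subst binomial_symmetric) auto
  also have "Suc (2 * k + d) choose Suc d = Suc (2 * k + d) choose (2 * k)"
    by (subst binomial_symmetric) auto
  finally have *: "of_nat (Suc d) * of_nat (Suc (2 * k + d) choose (2 * k)) =
                  (of_nat (Suc (2 * k + d)) * of_nat ((2 * k + d) choose (2 * k)) :: 'a)"
    unfolding of_nat_mult[symmetric] by (rule arg_cong)
  have eq: "Suc n + k = Suc (2 * k + d)" "n + k = 2 * k + d"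
    by (simp_all add: d)
  have "(of_nat n + 1 - of_nat k) * koebe_coeff (Suc n) k =
          of_nat (Suc d) * of_nat (Suc (2 * k + d) choose (2 * k)) * (16 * (16 ^ n / 16 ^ k) :: 'a)"
    unfolding koebe_coeff_def eq by (simp add: d mult_ac del: binomial_Suc_Suc)
  also have "\<dots> = 16 * (of_nat n + 1 + of_nat k) * koebe_coeff n k"
    unfolding koebe_coeff_def eq * by (simp add: d mult_ac)
  finally show ?thesis .
next
  case False
  thus ?thesis
    by (cases "k = Suc n") (simp_all add: koebe_coeff_eq_0)
qed

text \<open>One absorption step lowers row and column, then a step within the row lowers the column
  again. The factor n - k is taken in the field, so it may be negative.\<close>

lemma koebe_coeff_Suc_right:
  "32 * (of_nat k + 1) * (2 * of_nat k + 1) * koebe_coeff n (Suc k) =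
     (of_nat n + of_nat k + 1) * (of_nat n - of_nat k) * (koebe_coeff n k :: 'a :: field_char_0)"
proof -
  let ?b = "\<lambda>m j. of_nat (m choose j) :: 'a"
  have 1: "of_nat (2 * k + 2) * ?b (Suc (n + k)) (2 * k + 2) =
             of_nat (Suc (n + k)) * ?b (n + k) (2 * k + 1)"
    unfolding of_nat_mult[symmetric]
    by (rule arg_cong[where f = of_nat])
       (use Suc_times_binomial_eq[of "n + k" "2 * k + 1"] in \<open>simp add: mult.commute\<close>)
  have 2: "of_nat (2 * k + 1) * ?b (n + k) (2 * k + 1) = (of_nat n - of_nat k) * ?b (n + k) (2 * k)"
    using gbinomial_mult_1[of "of_nat (n + k) :: 'a" "2 * k"]
    by (simp add: binomial_gbinomial algebra_simps)
  have "32 * (of_nat k + 1) * (2 * of_nat k + 1) * koebe_coeff n (Suc k) =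
          of_nat (2 * k + 1) * of_nat (2 * k + 2) * ?b (Suc (n + k)) (2 * k + 2) * (16 ^ n / 16 ^ k)"
    by (simp add: koebe_coeff_def field_simps del: binomial_Suc_Suc)
  also have "of_nat (2 * k + 1) * of_nat (2 * k + 2) * ?b (Suc (n + k)) (2 * k + 2) =
          of_nat (Suc (n + k)) * (of_nat (2 * k + 1) * ?b (n + k) (2 * k + 1))"
    using 1 by (simp only: mult_ac)
  also have "\<dots> = of_nat (Suc (n + k)) * ((of_nat n - of_nat k) * ?b (n + k) (2 * k))"
    unfolding 2 ..
  finally show ?thesis
    by (simp add: koebe_coeff_def mult_ac)
qed

text \<open>The recurrence operator of \<^const>\<open>V\<close> turns \<open>koebe_coeff\<close> into two terms that telescope once
  weighted with \<open>(-1) ^ k * of_nat (cb k) ^ 3\<close>, whose consecutive ratio is \<open>-8 * (2 * k + 1) ^ 3 / (k + 1) ^ 3\<close>.\<close>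

lemma koebe_coeff_rec:
  fixes m k :: nat
  defines "M \<equiv> (of_nat m :: 'a :: field_char_0)" and "K \<equiv> (of_nat k :: 'a)"
  shows "(M + 2) ^ 3 * koebe_coeff (m + 2) k - 8 * (2 * M + 3) * (2 * M ^ 2 + 6 * M + 5) * koebe_coeff (m + 1) k
           + 256 * (M + 1) ^ 3 * koebe_coeff m k =
         K ^ 3 * (koebe_coeff (m + 2) k - 256 * koebe_coeff m k) +
           8 * (2 * K + 1) ^ 3 * (koebe_coeff (m + 2) (Suc k) - 256 * koebe_coeff m (Suc k))"
proof -
  have "K + 1 = of_nat (Suc k)" "2 * K + 1 = of_nat (2 * k + 1)"
    by (simp_all add: K_def)
  hence nzK: "K + 1 \<noteq> 0" "2 * K + 1 \<noteq> 0"
    by (metis of_nat_eq_0_iff nat.distinct(1), metis of_nat_eq_0_iff add_is_0 one_neq_zero)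
  have R: "koebe_coeff n (Suc k) = (of_nat n + K + 1) * (of_nat n - K) * koebe_coeff n k / (32 * (K + 1) * (2 * K + 1))" for n
  proof (subst nonzero_eq_divide_eq)
    show "32 * (K + 1) * (2 * K + 1) \<noteq> 0"
      using nzK by (metis mult_eq_0_iff zero_neq_numeral)
  qed (use koebe_coeff_Suc_right[of k n, where ?'a = 'a] in \<open>simp add: K_def mult_ac\<close>)
  \<comment> \<open>The generic case divides by m - k + 1 and m - k + 2, which vanish at k = m + 1
    and k = m + 2. These two are checked directly; beyond them every term is 0.\<close>
  consider d where "m = k + d" | "k = Suc m" | "k = Suc (Suc m)" | "k > m + 2"
    by (metis add_2_eq_Suc' less_eqE linorder_neqE_nat not_less_eq not_less)
  thus ?thesis
  proof cases
    case 1
    define D where "D = (of_nat d :: 'a)"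
    have M: "M = K + D"
      by (simp add: M_def K_def D_def 1)
    have nz: "D + 1 \<noteq> 0" "D + 2 \<noteq> 0"
      unfolding D_def by (metis of_nat_neq_0 of_nat_Suc add.commute,
          metis of_nat_eq_0_iff of_nat_add of_nat_numeral add_is_0 zero_neq_numeral)
    \<comment> \<open>Taking out all denominators makes each of the five coefficients a polynomial
      in K and D times u.\<close>
    define u where "u = koebe_coeff m k / (32 * (K + 1) * (2 * K + 1) * (D + 1) * (D + 2))"
    have w0: "koebe_coeff m k = 32 * (K + 1) * (2 * K + 1) * (D + 1) * (D + 2) * u"
      using nz nzK by (simp add: u_def del: distrib_left_numeral)
    have w1: "koebe_coeff (m + 1) k = 512 * (2 * K + D + 1) * (K + 1) * (2 * K + 1) * (D + 2) * u"
    proof -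
      have "(D + 1) * koebe_coeff (m + 1) k = 16 * (2 * K + D + 1) * koebe_coeff m k"
        using koebe_coeff_Suc_left[of m k, where ?'a = 'a] unfolding M_def[symmetric] K_def[symmetric] M
        by (simp add: algebra_simps)
      also have "\<dots> = (D + 1) * (512 * (2 * K + D + 1) * (K + 1) * (2 * K + 1) * (D + 2) * u)"
        unfolding w0 by algebra
      finally show ?thesis
        using nz by (simp only: mult_cancel_left) simp
    qed
    have w2: "koebe_coeff (m + 2) k = 8192 * (2 * K + D + 2) * (2 * K + D + 1) * (K + 1) * (2 * K + 1) * u"
    proof -
      have "(D + 2) * koebe_coeff (m + 2) k = 16 * (2 * K + D + 2) * koebe_coeff (m + 1) k"
        using koebe_coeff_Suc_left[of "m + 1" k, where ?'a = 'a]
        unfolding of_nat_add of_nat_1 M_def[symmetric] K_def[symmetric] M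
        by (simp add: algebra_simps)
      also have "\<dots> = (D + 2) * (8192 * (2 * K + D + 2) * (2 * K + D + 1) * (K + 1) * (2 * K + 1) * u)"
        unfolding w1 by algebra
      finally show ?thesis
        using nz by (simp only: mult_cancel_left) simp
    qed
    have w3: "koebe_coeff m (Suc k) = (2 * K + D + 1) * D * (D + 1) * (D + 2) * u"
    proof -
      have "koebe_coeff m (Suc k) = (2 * K + D + 1) * D * koebe_coeff m k / (32 * (K + 1) * (2 * K + 1))"
        unfolding R M_def[symmetric] M by (simp add: algebra_simps)
      thus ?thesis
        unfolding w0 using nzK by (simp del: distrib_left_numeral)
    qed
    have w4: "koebe_coeff (m + 2) (Suc k) = 256 * (2 * K + D + 3) * (2 * K + D + 2) * (2 * K + D + 1) * (D + 2) * u"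
    proof -
      have "koebe_coeff (m + 2) (Suc k) = (2 * K + D + 3) * (D + 2) * koebe_coeff (m + 2) k / (32 * (K + 1) * (2 * K + 1))"
        unfolding R of_nat_add of_nat_numeral M_def[symmetric] M by (simp add: algebra_simps)
      thus ?thesis
        unfolding w2 using nzK by (simp add: divide_simps del: distrib_left_numeral)
    qed
    \<comment> \<open>Naming the cofactors of u reduces the claim to one polynomial identity in K
      and D.\<close>
    define p0 p1 p2 p3 p4 where
      "p0 = 32 * (K + 1) * (2 * K + 1) * (D + 1) * (D + 2)" and
      "p1 = 512 * (2 * K + D + 1) * (K + 1) * (2 * K + 1) * (D + 2)" and
      "p2 = 8192 * (2 * K + D + 2) * (2 * K + D + 1) * (K + 1) * (2 * K + 1)" and
      "p3 = (2 * K + D + 1) * D * (D + 1) * (D + 2)" and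
      "p4 = 256 * (2 * K + D + 3) * (2 * K + D + 2) * (2 * K + D + 1) * (D + 2)"
    note p_defs = this
    have "(M + 2) ^ 3 * p2 - 8 * (2 * M + 3) * (2 * M ^ 2 + 6 * M + 5) * p1 + 256 * (M + 1) ^ 3 * p0 =
            K ^ 3 * (p2 - 256 * p0) + 8 * (2 * K + 1) ^ 3 * (p4 - 256 * p3)"
      unfolding p_defs M by algebra
    hence "((M + 2) ^ 3 * p2 - 8 * (2 * M + 3) * (2 * M ^ 2 + 6 * M + 5) * p1 + 256 * (M + 1) ^ 3 * p0) * u =
            (K ^ 3 * (p2 - 256 * p0) + 8 * (2 * K + 1) ^ 3 * (p4 - 256 * p3)) * u"
      by (rule arg_cong)
    thus ?thesis
      unfolding w0 w1 w2 w3 w4 p_defs[symmetric]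
      by (simp only: distrib_right left_diff_distrib right_diff_distrib mult.assoc)
  next
    case 2
    have w1: "koebe_coeff (m + 1) k = (1 :: 'a)" "koebe_coeff m k = (0 :: 'a)"
      "koebe_coeff m (Suc k) = (0 :: 'a)" "koebe_coeff (m + 2) (Suc k) = (1 :: 'a)"
      using koebe_coeff_self[of "Suc m", where ?'a = 'a] koebe_coeff_self[of "Suc (Suc m)", where ?'a = 'a]
      by (simp_all add: 2 koebe_coeff_eq_0)
    have w2: "koebe_coeff (m + 2) k = (16 * (2 * M + 3) :: 'a)"
      using koebe_coeff_Suc_left[of "Suc m" k, where ?'a = 'a] w1 by (simp add: 2 M_def)
    have K: "K = M + 1" by (simp add: K_def M_def 2)
    show ?thesis unfolding w1 w2 K by algebra
  next
    case 3
    thus ?thesis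
      by (simp add: koebe_coeff_eq_0 koebe_coeff_self M_def K_def add.commute)
  next
    case 4
    thus ?thesis by (simp add: koebe_coeff_eq_0)
  qed
qed

text \<open>Both sides satisfy \<open>V_rec\<close> and agree at n = 0 and n = 1, and the leading
  factor \<open>of_nat (m + 2) ^ 3\<close> is never zero.\<close>

lemma V_eq_sum:
  "(of_nat (V n) :: 'a :: field_char_0) = (\<Sum>k\<le>n. (-1) ^ k * of_nat (cb k) ^ 3 * koebe_coeff n k)"
proof -
  define c where "c = (\<lambda>k. (-1) ^ k * of_nat (cb k) ^ 3 :: 'a)"
  define h where "h = (\<lambda>n. \<Sum>k\<le>n. c k * koebe_coeff n k)"
  \<comment> \<open>Padding with zero terms gives the sums for m, m + 1 and m + 2 a common
    range.\<close>
  have h_upto: "h n = (\<Sum>k<N. c k * koebe_coeff n k)" if "n < N" for n N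
    unfolding h_def using that by (intro sum.mono_neutral_left) (auto simp: koebe_coeff_eq_0)
  have c_Suc: "of_nat (Suc k) ^ 3 * c (Suc k) = - 8 * (2 * of_nat k + 1) ^ 3 * c k" for k
  proof -
    have "of_nat (Suc k) ^ 3 * c (Suc k) = - ((-1) ^ k * ((of_nat k + 1) * of_nat (cb (Suc k))) ^ 3)"
      by (simp add: c_def power_mult_distrib add.commute mult_ac del: binomial_Suc_Suc mult_Suc_right)
    also have "\<dots> = - 8 * (2 * of_nat k + 1) ^ 3 * c k"
      unfolding of_nat_cb_Suc by (simp add: c_def power3_eq_cube algebra_simps)
    finally show ?thesis .
  qed
  have h_rec: "of_nat (m + 2) ^ 3 * h (m + 2) =
      8 * (2 * of_nat m + 3) * (2 * of_nat m ^ 2 + 6 * of_nat m + 5) * h (m + 1)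
      - 256 * of_nat (m + 1) ^ 3 * h m" for m
  proof -
    define M where "M = (of_nat m :: 'a)"
    \<comment> \<open>The telescoping certificate: its factor k^3 lets \<open>c_Suc\<close> identify
      the second term of \<open>koebe_coeff_rec\<close>, multiplied by \<open>c k\<close>, with
      \<open>- e (Suc k)\<close>.\<close>
    define e where "e = (\<lambda>k. of_nat k ^ 3 * c k * (koebe_coeff (m + 2) k - 256 * koebe_coeff m k))"
    have step: "c k * ((M + 2) ^ 3 * koebe_coeff (m + 2) k - 8 * (2 * M + 3) * (2 * M ^ 2 + 6 * M + 5) * koebe_coeff (m + 1) k
                  + 256 * (M + 1) ^ 3 * koebe_coeff m k) = e k - e (Suc k)" for k
      unfolding M_def koebe_coeff_rec e_def c_Suc by (simp add: algebra_simps)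
    have "(M + 2) ^ 3 * h (m + 2) - 8 * (2 * M + 3) * (2 * M ^ 2 + 6 * M + 5) * h (m + 1)
                  + 256 * (M + 1) ^ 3 * h m = (\<Sum>k<m+3. e k - e (Suc k))"
      unfolding step[symmetric]
      by (simp only: h_upto[of "m + 2" "m + 3"] h_upto[of "m + 1" "m + 3"] h_upto[of m "m + 3"])
         (simp add: sum_distrib_left sum.distrib sum_subtractf ring_distribs mult_ac)
    also have "\<dots> = e 0 - e (m + 3)"
      by (rule sum_lessThan_telescope')
    \<comment> \<open>The left end vanishes by the factor k^3, the right end because m + 3 exceeds m
      + 2.\<close>
    also have "\<dots> = 0"
      by (simp add: e_def koebe_coeff_eq_0)
    finally show ?thesis
      by (simp add: M_def algebra_simps)
  qed
  have "of_nat (V n) = h n"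
  proof (induction n rule: less_induct)
    case (less n)
    consider "n = 0" | "n = 1" | m where "n = m + 2"
      by (metis One_nat_def add_2_eq_Suc' not0_implies_Suc)
    thus ?case
    proof cases
      case 3
      have "of_nat (m + 2) ^ 3 * of_nat (V (m + 2)) = of_nat (m + 2) ^ 3 * h (m + 2)"
        unfolding V_rec h_rec using less[of m] less[of "m + 1"] by (simp add: 3)
      moreover have "of_nat (m + 2) ^ 3 \<noteq> (0 :: 'a)"
        by (metis power_not_zero of_nat_eq_0_iff add_is_0 zero_neq_numeral)
      ultimately show ?thesis
        unfolding 3 using mult_left_cancel by blast
    qed (simp_all add: V_def h_def c_def koebe_coeff_def choose_two)
  qed
  thus ?thesis
    by (simp add: h_def c_def)
qed

section \<open>The identity of formal power series\<close>

definition koebe_fps :: "'a :: field_char_0 fps" where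
  "koebe_fps = - fps_X * inverse ((1 - 16 * fps_X) ^ 2)"

lemma koebe_fps_nth_0 [simp]: "koebe_fps $ 0 = 0"
  by (simp add: koebe_fps_def)

text \<open>Up to sign the product is x^k / (1 - 16 x)^(2 k + 1), so the negative binomial series
  gives its coefficients.\<close>

lemma koebe_fps_power_nth:
  "(inverse (1 - 16 * fps_X) * koebe_fps ^ k :: 'a :: field_char_0 fps) $ n =
     (if k \<le> n then (-1) ^ k * koebe_coeff n k else 0)"
proof -
  define I where "I = (inverse (1 - 16 * fps_X) :: 'a fps)"
  have "koebe_fps ^ k = (- (fps_X * I ^ 2)) ^ k"
    by (simp add: koebe_fps_def I_def fps_inverse_power)
  also have "\<dots> = (-1) ^ k * fps_X ^ k * I ^ (2 * k)"
    by (subst power_minus) (simp add: power_mult_distrib mult_ac flip: power_mult)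
  finally have "I * koebe_fps ^ k = fps_const ((-1) ^ k) * (fps_X ^ k * I ^ (2 * k + 1))"
    by (simp add: fps_const_power [symmetric] fps_const_neg [symmetric] mult_ac
          del: fps_const_power fps_const_neg)
  also have "I ^ (2 * k + 1) = inverse ((1 - fps_const 16 * fps_X) ^ (2 * k + 1))"
    unfolding I_def fps_inverse_power numeral_fps_const ..
  also have "(fps_const ((-1) ^ k) * (fps_X ^ k * \<dots>)) $ n = (if k \<le> n then (-1) ^ k * koebe_coeff n k else 0)"
  proof (cases "k \<le> n")
    case True
    hence "(2 * k + 1 + (n - k) - 1) choose (n - k) = (n + k) choose (2 * k)"
      using binomial_symmetric[of "n - k" "n + k"] by (simp add: mult_2 add.commute)
    with True show ?thesis
      by (subst one_minus_const_fps_X_neg_power') (simp_all add: fps_X_power_mult_nth koebe_coeff_def power_diff)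
  qed (simp_all add: fps_X_power_mult_nth)
  finally show ?thesis
    by (simp add: I_def)
qed

lemma V_fps: "cb_fps 2 ^ 2 = (inverse (1 - 16 * fps_X) * (cb_fps 3 oo koebe_fps) :: 'a :: field_char_0 fps)"
proof (rule fps_ext)
  fix n
  let ?G = "inverse (1 - 16 * fps_X) :: 'a fps"
  \<comment> \<open>\<open>koebe_fps ^ k\<close> starts at order k, so the inner sums may run to n
    for every i; the order of summation can then be swapped.\<close>
  have "(?G * (cb_fps 3 oo koebe_fps)) $ n =
          (\<Sum>i=0..n. ?G $ i * (\<Sum>k=0..n. cb_fps 3 $ k * (koebe_fps ^ k) $ (n - i)))"
    unfolding fps_mult_nth fps_compose_nth
    by (intro sum.cong refl arg_cong2[where f = "(*)"] sum.mono_neutral_left)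
       (auto simp: startsby_zero_power_prefix)
  also have "\<dots> = (\<Sum>k=0..n. cb_fps 3 $ k * (?G * koebe_fps ^ k) $ n)"
    unfolding fps_mult_nth sum_distrib_left by (subst sum.swap) (simp add: mult_ac)
  also have "\<dots> = (\<Sum>k=0..n. (-1) ^ k * of_nat (cb k) ^ 3 * koebe_coeff n k)"
    by (intro sum.cong refl) (simp add: koebe_fps_power_nth cb_fps_def)
  also have "\<dots> = (cb_fps 2 ^ 2) $ n"
    by (simp add: V_eq_sum atLeast0AtMost flip: V_eq_fps_nth)
  finally show "(cb_fps 2 ^ 2) $ n = (?G * (cb_fps 3 oo koebe_fps)) $ n" ..
qed

section \<open>Radii of convergence and the analytic sum for \<open>V\<close>\<close>

lemma fps_conv_radius_cb_fps: "fps_conv_radius (cb_fps r :: complex fps) = ereal (1 / 4 ^ r)"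
  unfolding fps_conv_radius_def
proof (rule conv_radius_ratio_limit_nonzero[OF refl])
  have ratio: "norm (cb_fps r $ k :: complex) / norm (cb_fps r $ Suc k :: complex) =
          ((real k + 1) / (2 * (2 * real k + 1))) ^ r" for k
  proof -
    have "real (cb k) / real (cb (Suc k)) = (real k + 1) / (2 * (2 * real k + 1))"
      using of_nat_cb_Suc[of k, where ?'a = real]
      by (simp add: divide_simps mult_ac del: binomial_Suc_Suc mult_Suc_right)
    thus ?thesis
      by (simp add: cb_fps_def norm_power power_divide[symmetric] del: binomial_Suc_Suc mult_Suc_right)
  qed
  have "(\<lambda>k. (real k + 1) / (2 * (2 * real k + 1))) \<longlonglongrightarrow> 1 / 4"
    by real_asymp
  from tendsto_power[OF this, of r]
  show "(\<lambda>k. norm (cb_fps r $ k :: complex) / norm (cb_fps r $ Suc k :: complex)) \<longlonglongrightarrow> 1 / 4 ^ r"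
    unfolding ratio by (simp add: power_divide)
qed auto

definition V_series :: "complex \<Rightarrow> complex" where
  "V_series = eval_fps (cb_fps 2 ^ 2)"

lemma fps_conv_radius_V: "ereal (1 / 16) \<le> fps_conv_radius (cb_fps 2 ^ 2 :: complex fps)"
  using fps_conv_radius_power[of "cb_fps 2 :: complex fps" 2]
  by (simp add: fps_conv_radius_cb_fps)

lemma V_series_sums:
  assumes "norm x < 1 / 16"
  shows   "(\<lambda>n. of_nat (V n) * x ^ n) sums V_series x"
proof -
  have "ereal (norm x) < ereal (1 / 16)"
    using assms by simp
  also have "\<dots> \<le> fps_conv_radius (cb_fps 2 ^ 2 :: complex fps)"
    by (rule fps_conv_radius_V)
  finally show ?thesis
    using sums_eval_fps[of x "cb_fps 2 ^ 2"] by (simp add: V_series_def V_eq_fps_nth)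
qed

lemma V_series_holomorphic: "V_series holomorphic_on ball 0 (1 / 16)"
proof -
  have "ball 0 (1 / 16) \<subseteq> eball (0 :: complex) (fps_conv_radius (cb_fps 2 ^ 2 :: complex fps))"
    by (rule ball_eball_mono[OF fps_conv_radius_V])
  thus ?thesis
    unfolding V_series_def by (intro holomorphic_on_eval_fps)
qed

section \<open>The Koebe function and its inverse on the cut plane\<close>

definition koebe :: "complex \<Rightarrow> complex" where
  "koebe x = - x / (1 - 16 * x)\<^sup>2"

definition koebe_inv :: "complex \<Rightarrow> complex" where
  "koebe_inv z = (csqrt (1 - 64 * z) - 1) / (16 * (csqrt (1 - 64 * z) + 1))"

text \<open>The map z \<mapsto> 1 - 64 z carries the cut to the branch cut of \<open>csqrt\<close>,
  so the root in \<open>koebe_inv\<close> is holomorphic on the cut plane.\<close>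

lemma cut_plane_iff: "z \<in> cut_plane \<longleftrightarrow> 1 - 64 * z \<notin> \<real>\<^sub>\<le>\<^sub>0"
proof -
  have "1 - 64 * z \<in> \<real>\<^sub>\<le>\<^sub>0 \<longleftrightarrow> Re z \<ge> 1 / 64 \<and> Im z = 0"
    by (auto simp: complex_nonpos_Reals_iff)
  also have "\<dots> \<longleftrightarrow> z \<notin> cut_plane"
    by (auto simp: cut_plane_def complex_eq_iff)
  finally show ?thesis
    by blast
qed

lemma Re_csqrt_pos:
  assumes "z \<notin> \<real>\<^sub>\<le>\<^sub>0"
  shows   "Re (csqrt z) > 0"
proof (rule ccontr)
  assume "\<not> Re (csqrt z) > 0"
  hence "Re (csqrt z) = 0"
    using Re_csqrt[of z] by linarith
  hence "(csqrt z)\<^sup>2 \<in> \<real>\<^sub>\<le>\<^sub>0"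
    by (simp add: complex_nonpos_Reals_iff power2_eq_square)
  with assms show False
    by simp
qed

lemma Re_pos_imp_square_notin_nonpos_Reals: "Re t > 0 \<Longrightarrow> t\<^sup>2 \<notin> \<real>\<^sub>\<le>\<^sub>0"
  by (auto simp: complex_nonpos_Reals_iff power2_eq_square mult_le_0_iff)

text \<open>The root s lies in the right half-plane, hence closer to 1 than to -1; so the Cayley
  transform (s - 1) / (s + 1) has norm below 1.\<close>

lemma norm_koebe_inv_less:
  assumes "z \<in> cut_plane"
  shows   "norm (koebe_inv z) < 1 / 16"
proof -
  define s where "s = csqrt (1 - 64 * z)"
  have s: "Re s > 0"
    using assms Re_csqrt_pos unfolding s_def cut_plane_iff by blast
  hence "(norm (s - 1))\<^sup>2 < (norm (s + 1))\<^sup>2"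
    unfolding cmod_power2 by (simp add: power2_eq_square algebra_simps)
  hence "norm (s - 1) < norm (s + 1)"
    by (rule power2_less_imp_less) simp
  thus ?thesis
    unfolding koebe_inv_def s_def[symmetric] norm_divide norm_mult
    by (simp add: divide_simps)
qed

lemma koebe_koebe_inv:
  assumes "z \<in> cut_plane"
  shows   "koebe (koebe_inv z) = z"
proof -
  define s where "s = csqrt (1 - 64 * z)"
  have "Re s > 0"
    using assms Re_csqrt_pos unfolding s_def cut_plane_iff by blast
  hence nz: "s + 1 \<noteq> 0"
    by (auto simp: complex_eq_iff)
  define b where "b = s + 1"
  have x: "koebe_inv z = (b - 2) / (16 * b)"
    by (simp add: koebe_inv_def s_def b_def)
  have "1 - 16 * koebe_inv z = 2 / b"
    unfolding x using nz[folded b_def] by (simp add: field_simps)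
  hence "koebe (koebe_inv z) = (1 - (b - 1)\<^sup>2) / 64"
    unfolding koebe_def x using nz[folded b_def] by (simp add: field_simps power2_eq_square)
  thus ?thesis
    by (simp add: b_def s_def)
qed

lemma one_minus_16_mult_nonzero:
  fixes x :: complex
  assumes "norm x < 1 / 16"
  shows   "1 - 16 * x \<noteq> 0"
proof
  assume "1 - 16 * x = 0"
  hence "x = 1 / 16" by (simp add: field_simps)
  with assms show False by simp
qed

text \<open>The quotient t = (1 + 16 x) / (1 - 16 x) inverts the Cayley transform, and t^2 = 1 - 64
  z for z = \<open>koebe x\<close>. As Re t > 0, t is the principal root of t^2, which gives both
  claims.\<close>

lemma
  assumes "norm x < 1 / 16"
  shows koebe_in_cut_plane: "koebe x \<in> cut_plane"
    and koebe_inv_koebe:    "koebe_inv (koebe x) = x"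
proof -
  define t where "t = (1 + 16 * x) / (1 - 16 * x)"
  have nz: "1 - 16 * x \<noteq> 0"
    using assms by (rule one_minus_16_mult_nonzero)
  have "(16 * norm x)\<^sup>2 < 1"
    unfolding abs_square_less_1 using assms by simp
  hence "1 - (16 * norm x)\<^sup>2 > 0"
    by simp
  \<comment> \<open>The real part of a quotient has the sign of the real part of numerator times
    conjugate denominator.\<close>
  also have "1 - (16 * norm x)\<^sup>2 = Re ((1 + 16 * x) * cnj (1 - 16 * x))"
    unfolding power_mult_distrib cmod_power2 by (simp add: power2_eq_square algebra_simps)
  finally have t: "Re t > 0"
    using nz unfolding t_def by (subst Re_complex_div_gt_0) simp
  have t2: "1 - 64 * koebe x = t\<^sup>2"
  proof -
    define d where "d = 1 - 16 * x"
    have x: "x = (1 - d) / 16"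
      by (simp add: d_def)
    show ?thesis
      unfolding koebe_def t_def d_def[symmetric] using nz unfolding d_def[symmetric]
      by (simp add: x field_simps power2_eq_square)
  qed
  show "koebe x \<in> cut_plane"
    unfolding cut_plane_iff t2 by (rule Re_pos_imp_square_notin_nonpos_Reals[OF t])
  have "csqrt (1 - 64 * koebe x) = t"
    unfolding t2 by (rule csqrt_square) (use t in auto)
  moreover have "(t - 1) / (16 * (t + 1)) = x"
  proof -
    have "t - 1 = 32 * x / (1 - 16 * x)" "t + 1 = 2 / (1 - 16 * x)"
      using nz by (simp_all add: t_def field_simps)
    thus ?thesis using nz by simp
  qed
  ultimately show "koebe_inv (koebe x) = x"
    by (simp add: koebe_inv_def)
qed

lemma koebe_inv_holomorphic: "koebe_inv holomorphic_on cut_plane"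
proof -
  have "csqrt z + 1 \<noteq> 0" for z
  proof
    assume "csqrt z + 1 = 0"
    hence "csqrt z = - 1"
      by (simp add: add_eq_0_iff2)
    thus False
      using Re_csqrt[of z] by simp
  qed
  thus ?thesis
    unfolding koebe_inv_def by (intro holomorphic_intros) (auto simp: cut_plane_iff simp del: distrib_left_numeral)
qed

section \<open>Analytic continuation of the series of cubes\<close>

text \<open>The claimed identity solved for the sum of cubes, at x = \<open>koebe_inv z\<close>. It
  thus holds on the whole disc by construction; what needs proof is the agreement with the power
  series of cubes.\<close>

definition cube_series :: "complex \<Rightarrow> complex" where
  "cube_series z = (1 - 16 * koebe_inv z) * V_series (koebe_inv z)"

lemma cube_series_holomorphic: "cube_series holomorphic_on cut_plane"
proof -
  have "(V_series \<circ> koebe_inv) holomorphic_on cut_plane"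
    by (rule holomorphic_on_compose_gen[OF koebe_inv_holomorphic V_series_holomorphic])
       (auto dest: norm_koebe_inv_less)
  thus ?thesis
    unfolding cube_series_def o_def by (intro holomorphic_intros koebe_inv_holomorphic)
qed

lemma open_cut_plane: "open cut_plane"
proof -
  have "cut_plane = (\<lambda>z. 1 - 64 * z) -` (- \<real>\<^sub>\<le>\<^sub>0)"
    by (auto simp: cut_plane_iff)
  also have "open \<dots>"
    by (intro open_vimage continuous_intros) (simp add: open_Compl)
  finally show ?thesis .
qed

lemma ball_subset_cut_plane: "ball 0 (1 / 64) \<subseteq> cut_plane"
proof
  fix z :: complex assume "z \<in> ball 0 (1 / 64)"
  thus "z \<in> cut_plane"
    by (auto simp: cut_plane_def)
qed

lemma koebe_has_fps_expansion: "koebe has_fps_expansion koebe_fps"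
proof -
  have "(\<lambda>x. - x * inverse ((1 - 16 * x) ^ 2)) has_fps_expansion (koebe_fps :: complex fps)"
    unfolding koebe_fps_def by (intro fps_expansion_intros) auto
  thus ?thesis
    by (simp add: koebe_def[abs_def] divide_inverse)
qed

text \<open>Transfers the formal identity \<open>V_fps\<close> to functions. It is claimed only near
  0, where \<open>koebe x\<close> stays within the disc of convergence of the cubes.\<close>

lemma V_series_koebe_near_0:
  "eventually (\<lambda>x. V_series x = inverse (1 - 16 * x) * eval_fps (cb_fps 3) (koebe x)) (nhds 0)"
proof -
  have "eval_fps (cb_fps 3) has_fps_expansion (cb_fps 3 :: complex fps)"
    by (rule eval_fps_has_fps_expansion) (simp add: fps_conv_radius_cb_fps)
  hence "(eval_fps (cb_fps 3) \<circ> koebe) has_fps_expansion (cb_fps 3 oo koebe_fps)"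
    by (rule has_fps_expansion_compose[OF _ koebe_has_fps_expansion]) simp
  hence "(\<lambda>x. inverse (1 - 16 * x) * (eval_fps (cb_fps 3) \<circ> koebe) x) has_fps_expansion (cb_fps 2 ^ 2)"
    unfolding V_fps
    by (rule has_fps_expansion_mult[rotated])
       (intro has_fps_expansion_inverse fps_expansion_intros, auto)
  thus ?thesis
    by (simp add: has_fps_expansion_def V_series_def)
qed

text \<open>Composition with \<open>koebe_inv\<close> carries the local identity to a neighbourhood
  of z = 0; the identity theorem extends it to the disc.\<close>

lemma cube_series_eq_eval_fps:
  assumes "norm z < 1 / 64"
  shows   "cube_series z = eval_fps (cb_fps 3) z"
proof -
  have 0: "0 \<in> cut_plane"
    by (auto simp: cut_plane_def)
  have "isCont koebe_inv 0"
    using koebe_inv_holomorphic open_cut_plane 0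
    by (metis holomorphic_on_imp_continuous_on continuous_on_eq_continuous_at)
  moreover have "koebe_inv 0 = 0"
    by (simp add: koebe_inv_def)
  ultimately have "filterlim koebe_inv (nhds 0) (nhds 0)"
    using tendsto_at_iff_tendsto_nhds[of koebe_inv 0] by (simp add: isCont_def)
  hence "eventually (\<lambda>z. V_series (koebe_inv z) =
           inverse (1 - 16 * koebe_inv z) * eval_fps (cb_fps 3) (koebe (koebe_inv z))) (nhds 0)"
    by (rule eventually_compose_filterlim[OF V_series_koebe_near_0])
  moreover have "eventually (\<lambda>z. z \<in> cut_plane) (nhds 0)"
    using open_cut_plane 0 by (rule eventually_nhds_in_open)
  ultimately have "eventually (\<lambda>z. cube_series z = eval_fps (cb_fps 3) z) (nhds 0)"
  proof eventually_elim
    case (elim z)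
    have "1 - 16 * koebe_inv z \<noteq> 0"
      by (intro one_minus_16_mult_nonzero norm_koebe_inv_less elim)
    thus ?case
      unfolding cube_series_def elim(1) koebe_koebe_inv[OF elim(2)] by simp
  qed
  then obtain U where U: "open U" "0 \<in> U" "\<And>z. z \<in> U \<Longrightarrow> cube_series z = eval_fps (cb_fps 3) z"
    by (auto simp: eventually_nhds)
  show ?thesis
  proof (rule analytic_continuation_open[where f = cube_series and g = "eval_fps (cb_fps 3)",
            of "U \<inter> ball 0 (1 / 64)" "ball 0 (1 / 64)"])
    show "cube_series holomorphic_on ball 0 (1 / 64)"
      using cube_series_holomorphic ball_subset_cut_plane by (rule holomorphic_on_subset)
    show "eval_fps (cb_fps 3) holomorphic_on ball 0 (1 / 64)"
      by (rule holomorphic_on_eval_fps) (simp add: fps_conv_radius_cb_fps)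
  qed (use U assms in auto)
qed

lemma cube_series_sums:
  assumes "norm z < 1 / 64"
  shows   "(\<lambda>k. of_nat (cb k) ^ 3 * z ^ k) sums cube_series z"
  using sums_eval_fps[of z "cb_fps 3"] assms
  by (simp add: cube_series_eq_eval_fps fps_conv_radius_cb_fps) (simp add: cb_fps_def)

lemma V_series_eq_cube_series:
  assumes "norm x < 1 / 16"
  shows   "V_series x = 1 / (1 - 16 * x) * cube_series (koebe x)"
proof -
  have "1 - 16 * x \<noteq> 0"
    using assms by (rule one_minus_16_mult_nonzero)
  thus ?thesis
    by (simp add: cube_series_def koebe_inv_koebe[OF assms])
qed

section \<open>The circle of convergence\<close>

text \<open>Consecutive quotients differ by the factor (2 k + 1) / (2 k + 2), so the induction step
  reduces to (2 k + 1) (2 k + 3) \<le> (2 k + 2)^2.\<close>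

lemma central_binomial_square_le: "(real (cb k) / 4 ^ k)\<^sup>2 \<le> 1 / (2 * real k + 1)"
proof (induction k)
  case (Suc k)
  have eq: "real (cb (Suc k)) / 4 ^ Suc k = (2 * real k + 1) / (2 * real k + 2) * (real (cb k) / 4 ^ k)"
  proof -
    have *: "real (cb (Suc k)) = 2 * (2 * real k + 1) * real (cb k) / (real k + 1)"
      using of_nat_cb_Suc[of k, where ?'a = real]
      by (subst nonzero_eq_divide_eq) (simp_all add: mult_ac del: binomial_Suc_Suc mult_Suc_right)
    show ?thesis
      unfolding * by (simp add: divide_simps) (simp add: algebra_simps)
  qed
  have "(real (cb (Suc k)) / 4 ^ Suc k)\<^sup>2 \<le> ((2 * real k + 1) / (2 * real k + 2))\<^sup>2 * (1 / (2 * real k + 1))"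
    unfolding eq power_mult_distrib using Suc.IH by (intro mult_left_mono) auto
  also have "\<dots> = (2 * real k + 1) / (2 * real k + 2)\<^sup>2"
    by (simp add: power2_eq_square)
  also have "\<dots> \<le> 1 / (2 * real (Suc k) + 1)"
    by (simp add: divide_simps power2_eq_square) (simp add: algebra_simps)
  finally show ?case .
qed auto

text \<open>Provides the majorant for the Weierstrass M-test on the closed disc of radius
  1/64.\<close>

lemma summable_cb_cube: "summable (\<lambda>k. real (cb k) ^ 3 / 64 ^ k)"
proof (rule summable_comparison_test')
  have "summable (\<lambda>k. real k powr (- 3 / 2))"
    by (subst summable_real_powr_iff) auto
  thus "summable (\<lambda>k. real (Suc k) powr (- 3 / 2))"
    by (subst summable_Suc_iff)
  show "norm (real (cb k) ^ 3 / 64 ^ k) \<le> real (Suc k) powr (- 3 / 2)" if "k \<ge> 0" for k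
  proof -
    have "(real (cb k) / 4 ^ k)\<^sup>2 \<le> 1 / real (Suc k)"
      using central_binomial_square_le[of k] by (rule order_trans) (simp add: divide_simps)
    hence "real (cb k) / 4 ^ k \<le> sqrt (1 / real (Suc k))"
      by (rule real_le_rsqrt)
    hence "(real (cb k) / 4 ^ k) ^ 3 \<le> sqrt (1 / real (Suc k)) ^ 3"
      by (intro power_mono) auto
    also have "sqrt (1 / real (Suc k)) = real (Suc k) powr (- 1 / 2)"
      by (simp add: powr_minus_divide powr_half_sqrt real_sqrt_divide)
    also have "\<dots> ^ 3 = real (Suc k) powr (- 3 / 2)"
      by (simp add: powr_powr flip: powr_realpow)
    also have "(real (cb k) / 4 ^ k) ^ 3 = real (cb k) ^ 3 / 64 ^ k"
      by (simp add: power_divide power_mult[symmetric] mult.commute[of k] power_mult)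
    finally show ?thesis by simp
  qed
qed

text \<open>Summability forces \<open>norm z\<close> \<le> 1/64. In the open disc both sides agree
  already; a boundary point off the cut is reached by continuity.\<close>

lemma suminf_cb_cube_eq:
  assumes "summable (\<lambda>k. of_nat (cb k) ^ 3 * z ^ k :: complex)" "z \<in> cut_plane"
  shows   "(\<Sum>k. of_nat (cb k) ^ 3 * z ^ k) = cube_series z"
proof -
  have z: "norm z \<le> 1 / 64"
    using conv_radius_geI[OF assms(1)] fps_conv_radius_cb_fps[of 3]
    by (simp add: fps_conv_radius_def cb_fps_def)
  define p where "p = (\<lambda>z :: complex. \<Sum>k. of_nat (cb k) ^ 3 * z ^ k)"
  have "uniform_limit (cball 0 (1 / 64)) (\<lambda>n z. \<Sum>k<n. of_nat (cb k) ^ 3 * z ^ k) p sequentially"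
    unfolding p_def
  proof (rule Weierstrass_m_test[OF _ summable_cb_cube])
    fix k and z :: complex assume "z \<in> cball 0 (1 / 64)"
    hence "norm z ^ k \<le> (1 / 64) ^ k"
      by (intro power_mono) auto
    hence "real (cb k) ^ 3 * norm z ^ k \<le> real (cb k) ^ 3 * (1 / 64) ^ k"
      by (intro mult_left_mono) auto
    thus "norm (of_nat (cb k) ^ 3 * z ^ k) \<le> real (cb k) ^ 3 / 64 ^ k"
      by (simp add: norm_mult norm_power power_divide)
  qed
  hence "continuous_on (cball 0 (1 / 64)) p"
    by (rule uniform_limit_theorem[rotated]) (auto intro!: always_eventually continuous_intros)
  hence cont: "continuous_on (cball 0 (1 / 64) \<inter> cut_plane) (\<lambda>z. p z - cube_series z)"
    by (intro continuous_intros)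
       (auto intro: continuous_on_subset holomorphic_on_imp_continuous_on[OF cube_series_holomorphic])
  \<comment> \<open>These points approach z along its radius; the factor is below 1, so they lie in
    the open disc even if z is on the circle.\<close>
  define y where "y = (\<lambda>n. of_real (1 - 1 / real (Suc n)) * z)"
  have y_ball: "y n \<in> ball 0 (1 / 64)" for n
  proof -
    have "norm (y n) \<le> (1 - 1 / real (Suc n)) * (1 / 64)"
      unfolding y_def norm_mult norm_of_real using z by (intro mult_mono) auto
    also have "\<dots> < 1 / 64"
      by simp
    finally show ?thesis
      by simp
  qed
  have "(\<lambda>n. 1 - 1 / real (Suc n)) \<longlonglongrightarrow> 1"
    by real_asymp
  from tendsto_mult[OF tendsto_of_real[OF this] tendsto_const[of z]] have "y \<longlonglongrightarrow> z"
    by (simp add: y_def)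
  with cont have "(\<lambda>n. p (y n) - cube_series (y n)) \<longlonglongrightarrow> p z - cube_series z"
  proof (rule continuous_on_tendsto_compose)
    show "z \<in> cball 0 (1 / 64) \<inter> cut_plane"
      using z assms(2) by simp
    have "y n \<in> cball 0 (1 / 64) \<inter> cut_plane" for n
      using y_ball[of n] ball_subset_cut_plane ball_subset_cball by blast
    thus "\<forall>\<^sub>F n in sequentially. y n \<in> cball 0 (1 / 64) \<inter> cut_plane"
      by simp
  qed
  moreover have "p (y n) - cube_series (y n) = 0" for n
    using cube_series_sums[of "y n"] y_ball[of n] by (simp add: p_def sums_iff)
  ultimately have "(\<lambda>n. 0) \<longlonglongrightarrow> p z - cube_series z"
    by simp
  hence "p z - cube_series z = 0"
    by (simp add: tendsto_const_iff)
  thus ?thesis by (simp add: p_def)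
qed

theorem theorem3p2:
  "(\<forall>x::complex. norm x < 1/16 \<longrightarrow>
      summable (\<lambda>n. of_nat (V n) * x ^ n) \<and>
      (summable (\<lambda>k. of_nat ((2 * k) choose k) ^ 3 * (- x / (1 - 16 * x)\<^sup>2) ^ k) \<longrightarrow>
        (\<Sum>n. of_nat (V n) * x ^ n) =
          1 / (1 - 16 * x) *
            (\<Sum>k. of_nat ((2 * k) choose k) ^ 3 * (- x / (1 - 16 * x)\<^sup>2) ^ k))) \<and>
   (\<exists>F :: complex \<Rightarrow> complex.
      F holomorphic_on cut_plane \<and>
      (\<forall>z. norm z < 1/64 \<longrightarrow> (\<lambda>k. of_nat ((2 * k) choose k) ^ 3 * z ^ k) sums F z) \<and>
      (\<forall>x. norm x < 1/16 \<longrightarrow>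
        - x / (1 - 16 * x)\<^sup>2 \<in> cut_plane \<and>
        (\<Sum>n. of_nat (V n) * x ^ n) = 1 / (1 - 16 * x) * F (- x / (1 - 16 * x)\<^sup>2)))"
  unfolding koebe_def[symmetric]
proof (intro conjI allI impI exI[of _ cube_series])
  fix x :: complex assume x: "norm x < 1 / 16"
  show "summable (\<lambda>n. of_nat (V n) * x ^ n)"
    using V_series_sums[OF x] by (rule sums_summable)
  show *: "(\<Sum>n. of_nat (V n) * x ^ n) = 1 / (1 - 16 * x) * cube_series (koebe x)"
    using sums_unique[OF V_series_sums[OF x]] V_series_eq_cube_series[OF x] by simp
  show "koebe x \<in> cut_plane"
    using x by (rule koebe_in_cut_plane)
  \<comment> \<open>Convergence puts \<open>koebe x\<close> in the closed disc of radius 1/64, where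
    the sum of the series equals the continuation.\<close>
  assume "summable (\<lambda>k. of_nat (cb k) ^ 3 * koebe x ^ k)"
  thus "(\<Sum>n. of_nat (V n) * x ^ n) = 1 / (1 - 16 * x) * (\<Sum>k. of_nat (cb k) ^ 3 * koebe x ^ k)"
    using * suminf_cb_cube_eq koebe_in_cut_plane[OF x] by simp
qed (use cube_series_holomorphic cube_series_sums in auto)

end
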